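(* Let $\mathcal N=\mathbb N^{\mathbb N}$ be the Baire space and let $\mathcal O(\mathcal N)$ be the represented space of open subsets of $\mathcal N$. There is a (lightface) $\Sigma^0_2$-subset of $\mathcal O(\mathcal N)$ which is not a Borel subset of $\mathcal O(\mathcal N)$.
   Context: A represented space is a pair $\mathbf X=(X,\delta_X)$ with $\delta_X:\subseteq\mathcal N\to X$ a partial surjective map; $p$ is a name of $x$ if $\delta_X(p)=x$. The topology of $\mathbf X$ is the final topology of $\delta_X$: $U\subseteq X$ is open iff $\delta_X^{-1}(U)$ is relatively open in $\mathrm{dom}(\delta_X)$. A function $f:\mathbf X\to\mathbf Y$ is continuous if it has a continuous realizer, i.e. a continuous $F:\mathrm{dom}(\delta_X)\to\mathrm{dom}(\delta_Y)$ with $\delta_Y(F(p))=f(\delta_X(p))$ for all $p$. The space $\mathcal N$ is represented by the identity. The Sierpiński space is $\mathbb S=\{\bot,\top\}$ with $\delta_{\mathbb S}(0^{\mathbb N})=\bot$ and $\delta_{\mathbb S}(p)=\top$ for $p\neq 0^{\mathbb N}$. $\mathcal C(\mathbf X,\mathbf Y)$ is the represented space of continuous functions from $\mathbf X$ to $\mathbf Y$, a name of $f$ being a standard effective encoding in $\mathcal N$ of any continuous realizer of $f$ (e.g. a list of pairs $(u,v)$ of finite sequences sufficient to evaluate the realizer on $\mathrm{dom}(\delta_X)$). $\mathcal O(\mathbf X)=\mathcal C(\mathbf X,\mathbb S)$, an open set being identified with its characteristic function; equivalently, a name of an open $O\subseteq\mathcal N$ enumerates cylinders whose union is $O$. The resulting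 topology on $\mathcal O(\mathcal N)$ is the Scott topology. A set $A\subseteq\mathbf X$ is a $\Sigma^0_2$-subset of $\mathbf X$ if there is a (lightface, i.e. effective) $\Sigma^0_2$ set $B\subseteq\mathcal N$ with $\delta_X^{-1}(A)=B\cap\mathrm{dom}(\delta_X)$. The class of Borel subsets of a topological space is the smallest class containing the open sets and closed under complements and countable unions. *)

theory Defs
  imports "HOL-Analysis.Analysis" "HOL-Library.Nat_Bijection"
begin

section \<open>Baire space\<close>

text \<open>
  The type \<^typ>\<open>nat \<Rightarrow> nat\<close> carries the library's product topology of the discrete topology
  on \<^typ>\<open>nat\<close>, so its type class topology is that of Baire space.
\<close>

type_synonym baire = "nat \<Rightarrow> nat"

definition init_seg :: "baire \<Rightarrow> nat \<Rightarrow> nat list" where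
  "init_seg x k = map x [0..<k]"

definition cylinder :: "nat list \<Rightarrow> baire set" where
  "cylinder u = {x. init_seg x (length u) = u}"


section \<open>Represented spaces\<close>

text \<open>
  A represented space is given by its representation, a partial map \<open>\<delta>\<close> from Baire space to
  a type; the underlying set is \<^term>\<open>ran \<delta>\<close>, so surjectivity holds by construction.
\<close>

type_synonym 'a rep_space = "baire \<Rightarrow> 'a option"

definition rep_topology :: "'a rep_space \<Rightarrow> 'a topology" where
  "rep_topology \<delta> = topology (\<lambda>U. U \<subseteq> ran \<delta> \<and>
     openin (top_of_set (dom \<delta>)) {p \<in> dom \<delta>. the (\<delta> p) \<in> U})"

definition continuous_realizer ::
    "'a rep_space \<Rightarrow> 'b rep_space \<Rightarrow> ('a \<Rightarrow> 'b) \<Rightarrow> (baire \<Rightarrow> baire) \<Rightarrow> bool" where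
  "continuous_realizer X Y f F \<longleftrightarrow> continuous_on (dom X) F \<and>
     (\<forall>p \<in> dom X. F p \<in> dom Y \<and> the (Y (F p)) = f (the (X p)))"

text \<open>
  An element \<open>p\<close> of Baire space is read as a list of pairs of finite sequences. A pair
  \<open>(u, v)\<close> asserts that the output on any input extending \<open>u\<close> extends \<open>v\<close>. On input \<open>x\<close>
  the list evaluates to \<open>y\<close> if all applicable pairs are true of \<open>y\<close> and they determine
  arbitrarily long initial segments of \<open>y\<close>.
\<close>

definition lists_pair :: "baire \<Rightarrow> nat list \<Rightarrow> nat list \<Rightarrow> bool" where
  "lists_pair p u v \<longleftrightarrow> (\<exists>k. p k = prod_encode (list_encode u, list_encode v))"

definition evaluates :: "baire \<Rightarrow> baire \<Rightarrow> baire \<Rightarrow> bool" where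
  "evaluates p x y \<longleftrightarrow>
     (\<forall>u v. lists_pair p u v \<and> x \<in> cylinder u \<longrightarrow> y \<in> cylinder v) \<and>
     (\<forall>n. \<exists>u v. lists_pair p u v \<and> x \<in> cylinder u \<and> n \<le> length v)"

text \<open>
  Functions on the set underlying \<open>X\<close> are rendered as HOL functions that are \<^const>\<open>undefined\<close>
  outside that set. No behaviour of the list is required on inputs outside \<^term>\<open>dom X\<close>.
\<close>

definition is_name_of_fun :: "'a rep_space \<Rightarrow> 'b rep_space \<Rightarrow> baire \<Rightarrow> ('a \<Rightarrow> 'b) \<Rightarrow> bool" where
  "is_name_of_fun X Y p f \<longleftrightarrow> f \<in> extensional (ran X) \<and>
     (\<exists>F. continuous_realizer X Y f F \<and> (\<forall>x \<in> dom X. evaluates p x (F x)))"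

definition fun_space :: "'a rep_space \<Rightarrow> 'b rep_space \<Rightarrow> ('a \<Rightarrow> 'b) rep_space" where
  "fun_space X Y p =
     (if \<exists>f. is_name_of_fun X Y p f then Some (THE f. is_name_of_fun X Y p f) else None)"

definition baire_space :: "baire rep_space" where
  "baire_space p = Some p"

text \<open>The points bottom and top are \<^const>\<open>False\<close> and \<^const>\<open>True\<close>.\<close>

definition sierpinski :: "bool rep_space" where
  "sierpinski p = Some (p \<noteq> (\<lambda>_. 0))"

definition opens :: "'a rep_space \<Rightarrow> 'a set rep_space" where
  "opens X p = map_option (\<lambda>f. {x \<in> ran X. f x}) (fun_space X sierpinski p)"


section \<open>Effective descriptive set theory\<close>

text \<open>
  Recursive functions of arity \<open>n\<close>. Only the values on lists of length \<open>n\<close> are meaningful.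
  The last rule is minimization of a function that always has a zero.
\<close>

inductive recursive_fun :: "nat \<Rightarrow> (nat list \<Rightarrow> nat) \<Rightarrow> bool" where
  zero: "recursive_fun n (\<lambda>xs. 0)"
| succ: "recursive_fun 1 (\<lambda>xs. Suc (xs ! 0))"
| proj: "i < n \<Longrightarrow> recursive_fun n (\<lambda>xs. xs ! i)"
| comp: "recursive_fun (length gs) f \<Longrightarrow> (\<forall>g \<in> set gs. recursive_fun n g) \<Longrightarrow>
    recursive_fun n (\<lambda>xs. f (map (\<lambda>g. g xs) gs))"
| prec: "recursive_fun n f \<Longrightarrow> recursive_fun (Suc (Suc n)) g \<Longrightarrow>
    recursive_fun (Suc n)
      (\<lambda>xs. rec_nat (f (tl xs)) (\<lambda>y r. g (y # r # tl xs)) (hd xs))"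
| mini: "recursive_fun (Suc n) f \<Longrightarrow> (\<forall>xs. length xs = n \<longrightarrow> (\<exists>y. f (y # xs) = 0)) \<Longrightarrow>
    recursive_fun n (\<lambda>xs. LEAST y. f (y # xs) = 0)"

definition comp_enum :: "nat set \<Rightarrow> bool" where
  "comp_enum W \<longleftrightarrow> (\<exists>f. recursive_fun 2 f \<and> W = {x. \<exists>y. f [x, y] = 0})"

text \<open>
  The union of a uniform sequence of effectively closed sets: the complement of the \<open>n\<close>-th
  closed set is the union of the cylinders whose codes, paired with \<open>n\<close>, lie in \<open>W\<close>.
\<close>

definition lightface_Sigma02 :: "baire set \<Rightarrow> bool" where
  "lightface_Sigma02 B \<longleftrightarrow> (\<exists>W. comp_enum W \<and>
     B = (\<Union>n. - (\<Union>u \<in> {u. prod_encode (n, list_encode u) \<in> W}. cylinder u)))"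

definition Sigma02_subset :: "'a rep_space \<Rightarrow> 'a set \<Rightarrow> bool" where
  "Sigma02_subset \<delta> A \<longleftrightarrow> A \<subseteq> ran \<delta> \<and>
     (\<exists>B. lightface_Sigma02 B \<and> {p \<in> dom \<delta>. the (\<delta> p) \<in> A} = B \<inter> dom \<delta>)"

definition borel_subset :: "'a topology \<Rightarrow> 'a set \<Rightarrow> bool" where
  "borel_subset T A \<longleftrightarrow> A \<in> sigma_sets (topspace T) {U. openin T U}"


section \<open>Well-definedness\<close>

lemma openin_rep_topology:
  "openin (rep_topology \<delta>) U \<longleftrightarrow>
     U \<subseteq> ran \<delta> \<and> openin (top_of_set (dom \<delta>)) {p \<in> dom \<delta>. the (\<delta> p) \<in> U}"
proof -
  let ?pre = "\<lambda>U. {p \<in> dom \<delta>. the (\<delta> p) \<in> U}"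
  have "istopology (\<lambda>U. U \<subseteq> ran \<delta> \<and> openin (top_of_set (dom \<delta>)) (?pre U))"
    unfolding istopology_def
  proof (intro conjI allI impI)
    fix S T
    assume S: "S \<subseteq> ran \<delta> \<and> openin (top_of_set (dom \<delta>)) (?pre S)"
      and T: "T \<subseteq> ran \<delta> \<and> openin (top_of_set (dom \<delta>)) (?pre T)"
    have "?pre (S \<inter> T) = ?pre S \<inter> ?pre T" by blast
    then show "openin (top_of_set (dom \<delta>)) (?pre (S \<inter> T))"
      using S T by (simp add: openin_Int)
    show "S \<inter> T \<subseteq> ran \<delta>" using S by blast
  next
    fix K
    assume K: "\<forall>S\<in>K. S \<subseteq> ran \<delta> \<and> openin (top_of_set (dom \<delta>)) (?pre S)"
    then show "\<Union>K \<subseteq> ran \<delta>" by blast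
    have "?pre (\<Union>K) = \<Union> (?pre ` K)" by blast
    moreover have "openin (top_of_set (dom \<delta>)) (\<Union> (?pre ` K))"
      using K by (intro openin_Union) blast
    ultimately show "openin (top_of_set (dom \<delta>)) (?pre (\<Union>K))" by simp
  qed
  then show ?thesis
    unfolding rep_topology_def by (simp add: topology_inverse')
qed

lemma topspace_rep_topology: "topspace (rep_topology \<delta>) = ran \<delta>"
proof -
  have "{p \<in> dom \<delta>. the (\<delta> p) \<in> ran \<delta>} = dom \<delta>"
    by (auto simp: ran_def)
  then have "openin (rep_topology \<delta>) (ran \<delta>)"
    by (simp add: openin_rep_topology)
  then show ?thesis
    using openin_rep_topology[of \<delta> "topspace (rep_topology \<delta>)"] openin_subset by blast
qed

lemma cylinder_iff: "x \<in> cylinder u \<longleftrightarrow> (\<forall>i < length u. x i = u ! i)"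
  unfolding cylinder_def init_seg_def mem_Collect_eq
  by (subst list_eq_iff_nth_eq) simp

lemma length_init_seg [simp]: "length (init_seg x k) = k"
  by (simp add: init_seg_def)

lemma mem_cylinder_init_seg: "y \<in> cylinder (init_seg x k) \<longleftrightarrow> (\<forall>i < k. y i = x i)"
  unfolding cylinder_iff length_init_seg by (simp add: init_seg_def)

lemma evaluates_unique:
  assumes "evaluates p x y" "evaluates p x z"
  shows "y = z"
proof
  fix i
  obtain u v where uv: "lists_pair p u v" "x \<in> cylinder u" "Suc i \<le> length v"
    using assms(1) unfolding evaluates_def by blast
  then have "y \<in> cylinder v" "z \<in> cylinder v"
    using assms unfolding evaluates_def by blast+
  then show "y i = z i"
    using uv(3) by (simp add: cylinder_iff)
qed

lemma is_name_of_fun_unique: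
  assumes "is_name_of_fun X Y p f" "is_name_of_fun X Y p g"
  shows "f = g"
proof
  fix a
  obtain F where F: "continuous_realizer X Y f F" "\<forall>x \<in> dom X. evaluates p x (F x)"
    using assms(1) unfolding is_name_of_fun_def by blast
  obtain G where G: "continuous_realizer X Y g G" "\<forall>x \<in> dom X. evaluates p x (G x)"
    using assms(2) unfolding is_name_of_fun_def by blast
  show "f a = g a"
  proof (cases "a \<in> ran X")
    case True
    then obtain q where q: "X q = Some a" by (auto simp: ran_def)
    then have "q \<in> dom X" by blast
    with F G have "F q = G q" using evaluates_unique by blast
    with F(1) G(1) q \<open>q \<in> dom X\<close> show ?thesis
      unfolding continuous_realizer_def by force
  next
    case False
    then show ?thesis
      using assms unfolding is_name_of_fun_def extensional_def by simp
  qed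
qed

lemma fun_space_eq_Some_iff: "fun_space X Y p = Some f \<longleftrightarrow> is_name_of_fun X Y p f"
proof
  assume "is_name_of_fun X Y p f"
  moreover from this have "(THE f. is_name_of_fun X Y p f) = f"
    by (blast intro: the_equality is_name_of_fun_unique)
  ultimately show "fun_space X Y p = Some f"
    unfolding fun_space_def by metis
next
  assume *: "fun_space X Y p = Some f"
  then obtain g where g: "is_name_of_fun X Y p g"
    unfolding fun_space_def by (metis option.distinct(1))
  then have "(THE f. is_name_of_fun X Y p f) = g"
    by (blast intro: the_equality is_name_of_fun_unique)
  with * g show "is_name_of_fun X Y p f"
    unfolding fun_space_def by (metis option.inject)
qed

lemma open_cylinder: "open (cylinder u)"
proof -
  have "cylinder u = (\<Inter>i\<in>{..<length u}. (\<lambda>x. x i) -` {u ! i})"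
    by (auto simp: cylinder_iff)
  moreover have "open ((\<lambda>x::baire. x i) -` {u ! i})" for i
    using open_discrete continuous_on_product_coordinates by (rule open_vimage)
  ultimately show ?thesis by auto
qed

lemma open_nonzero: "open (- {(\<lambda>_. 0) :: baire})"
proof -
  have eq: "- {(\<lambda>_. 0) :: baire} = (\<Union>i. (\<lambda>x. x i) -` (- {0}))"
    by (rule set_eqI) (simp add: fun_eq_iff)
  have "open ((\<lambda>x::baire. x i) -` (- {0}))" for i
    using open_discrete continuous_on_product_coordinates by (rule open_vimage)
  then show ?thesis
    unfolding eq by (intro open_UN ballI)
qed

lemma open_contains_cylinder:
  assumes "open U" "x \<in> U"
  shows "\<exists>k. cylinder (init_seg x k) \<subseteq> U"
proof -
  obtain V where V: "x \<in> Pi\<^sub>E UNIV V" "finite {i. V i \<noteq> UNIV}" "Pi\<^sub>E UNIV V \<subseteq> U"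
    using product_topology_open_contains_basis[of "\<lambda>_. euclidean" UNIV U x] assms
    by (simp add: open_fun_def) blast
  obtain k where k: "\<forall>i \<in> {i. V i \<noteq> UNIV}. i < k"
    using V(2) by (meson finite_nat_set_iff_bounded)
  have "cylinder (init_seg x k) \<subseteq> Pi\<^sub>E UNIV V"
  proof
    fix y assume y: "y \<in> cylinder (init_seg x k)"
    have "y i \<in> V i" for i
    proof (cases "V i = UNIV")
      case False
      then have "y i = x i" using k y by (simp add: mem_cylinder_init_seg)
      then show ?thesis using V(1) by auto
    qed simp
    then show "y \<in> Pi\<^sub>E UNIV V" by auto
  qed
  then show ?thesis using V(3) by blast
qed

lemma ran_fun_space:
  "ran (fun_space X Y) = {f \<in> extensional (ran X). \<exists>F. continuous_realizer X Y f F}"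
proof (intro equalityI subsetI)
  fix f assume "f \<in> ran (fun_space X Y)"
  then show "f \<in> {f \<in> extensional (ran X). \<exists>F. continuous_realizer X Y f F}"
    by (auto simp: ran_def fun_space_eq_Some_iff is_name_of_fun_def)
next
  fix f assume "f \<in> {f \<in> extensional (ran X). \<exists>F. continuous_realizer X Y f F}"
  then obtain F where f: "f \<in> extensional (ran X)" and F: "continuous_realizer X Y f F"
    by blast
  define P where "P = {prod_encode (list_encode u, list_encode v) |u v.
    F ` (cylinder u \<inter> dom X) \<subseteq> cylinder v}"
  define p where "p = from_nat_into P"
  have "cylinder [] = UNIV" by (simp add: cylinder_def init_seg_def)
  then have "P \<noteq> {}" unfolding P_def by blast
  then have "range p = P"
    unfolding p_def by (simp add: range_from_nat_into)
  then have p: "lists_pair p u v \<longleftrightarrow> F ` (cylinder u \<inter> dom X) \<subseteq> cylinder v" for u v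
  proof -
    have "lists_pair p u v \<longleftrightarrow> prod_encode (list_encode u, list_encode v) \<in> P"
      unfolding lists_pair_def using \<open>range p = P\<close> by (metis rangeE rangeI)
    then show ?thesis by (auto simp: P_def prod_encode_eq list_encode_eq)
  qed
  have "evaluates p x (F x)" if x: "x \<in> dom X" for x
    unfolding evaluates_def
  proof (intro conjI allI impI)
    fix u v assume "lists_pair p u v \<and> x \<in> cylinder u"
    then show "F x \<in> cylinder v" using p x by blast
  next
    fix n
    have "F x \<in> cylinder (init_seg (F x) n)" by (simp add: mem_cylinder_init_seg)
    then obtain T where T: "open T" "x \<in> T"
      "\<forall>y \<in> dom X. y \<in> T \<longrightarrow> F y \<in> cylinder (init_seg (F x) n)"
      using F x open_cylinder unfolding continuous_realizer_def continuous_on_topological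
      by blast
    then obtain k where "cylinder (init_seg x k) \<subseteq> T"
      using open_contains_cylinder by blast
    with T(3) have "lists_pair p (init_seg x k) (init_seg (F x) n)"
      unfolding p by blast
    then show "\<exists>u v. lists_pair p u v \<and> x \<in> cylinder u \<and> n \<le> length v"
      by (metis length_init_seg mem_cylinder_init_seg order_refl)
  qed
  then have "fun_space X Y p = Some f"
    using f F unfolding fun_space_eq_Some_iff is_name_of_fun_def by blast
  then show "f \<in> ran (fun_space X Y)" by (auto simp: ran_def)
qed

lemma ran_baire_space [simp]: "ran baire_space = UNIV"
  by (rule set_eqI) (simp add: ran_def baire_space_def)

lemma dom_baire_space [simp]: "dom baire_space = UNIV"
  by (simp add: dom_def baire_space_def)

lemma dom_sierpinski [simp]: "dom sierpinski = UNIV"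
  by (simp add: dom_def sierpinski_def)

lemma continuous_realizer_baire_sierpinski:
  "continuous_realizer baire_space sierpinski f F \<longleftrightarrow>
     continuous_on UNIV F \<and> (\<forall>x. f x \<longleftrightarrow> F x \<in> - {\<lambda>_. 0})"
  unfolding continuous_realizer_def dom_baire_space dom_sierpinski
  by (simp only: baire_space_def sierpinski_def option.sel) blast

lemma ran_opens_baire_space: "ran (opens baire_space) = {U. open U}"
proof -
  have "opens baire_space = (\<lambda>p. map_option Collect (fun_space baire_space sierpinski p))"
    by (rule ext) (simp add: opens_def)
  then have "ran (opens baire_space) = Collect ` ran (fun_space baire_space sierpinski)"
    by (simp only: ran_map_option)
  also have "\<dots> = {U. open U}"
  proof (intro equalityI subsetI)
    fix U assume "U \<in> Collect ` ran (fun_space baire_space sierpinski)"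
    then obtain f where f: "U = Collect f" "f \<in> ran (fun_space baire_space sierpinski)"
      by blast
    then obtain F where "continuous_realizer baire_space sierpinski f F"
      unfolding ran_fun_space by blast
    then have F: "continuous_on UNIV F" "\<forall>x. f x \<longleftrightarrow> F x \<in> - {\<lambda>_. 0}"
      unfolding continuous_realizer_baire_sierpinski by blast+
    have "U = F -` (- {\<lambda>_. 0})"
      unfolding f(1) using F(2) by blast
    moreover have "open (F -` (- {\<lambda>_. 0}))"
      using open_nonzero F(1) by (rule open_vimage)
    ultimately show "U \<in> {U. open U}" by simp
  next
    fix U :: "baire set" assume "U \<in> {U. open U}"
    then have U: "open U" by simp
    define F :: "baire \<Rightarrow> baire" where
      "F x n = of_bool (cylinder (init_seg x n) \<subseteq> U)" for x n
    have cont: "continuous_on UNIV (\<lambda>x. F x n)" for n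
      unfolding continuous_on_topological
    proof (intro ballI allI impI)
      fix x B assume "open B" "F x n \<in> B"
      have "F y n \<in> B" if "y \<in> cylinder (init_seg x n)" for y
      proof -
        have "init_seg y n = init_seg x n"
          using that unfolding cylinder_def by simp
        then have "F y n = F x n" unfolding F_def by simp
        then show ?thesis using \<open>F x n \<in> B\<close> by simp
      qed
      moreover have "x \<in> cylinder (init_seg x n)"
        by (simp add: mem_cylinder_init_seg)
      ultimately show "\<exists>A. open A \<and> x \<in> A \<and> (\<forall>y\<in>UNIV. y \<in> A \<longrightarrow> F y n \<in> B)"
        using open_cylinder by blast
    qed
    have "continuous_on UNIV F"
      by (rule continuous_on_coordinatewise_then_product) (rule cont)
    moreover have "x \<in> U \<longleftrightarrow> F x \<in> - {\<lambda>_. 0}" for x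
    proof
      assume "F x \<in> - {\<lambda>_. 0}"
      then obtain n where "F x n \<noteq> 0" by (auto simp: fun_eq_iff)
      then have "cylinder (init_seg x n) \<subseteq> U" by (simp add: F_def)
      then show "x \<in> U" using mem_cylinder_init_seg by blast
    next
      assume "x \<in> U"
      then obtain k where "cylinder (init_seg x k) \<subseteq> U"
        using open_contains_cylinder U by blast
      then have "F x k = 1" by (simp add: F_def)
      then have "F x \<noteq> (\<lambda>_. 0)" by (metis zero_neq_one)
      then show "F x \<in> - {\<lambda>_. 0}" by simp
    qed
    ultimately have "continuous_realizer baire_space sierpinski (\<lambda>x. x \<in> U) F"
      unfolding continuous_realizer_baire_sierpinski by blast
    then have "(\<lambda>x. x \<in> U) \<in> ran (fun_space baire_space sierpinski)"
      unfolding ran_fun_space by simp blast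
    then have "Collect (\<lambda>x. x \<in> U) \<in> Collect ` ran (fun_space baire_space sierpinski)"
      by (rule imageI)
    then show "U \<in> Collect ` ran (fun_space baire_space sierpinski)"
      by (simp only: Collect_mem_eq)
  qed
  finally show ?thesis .
qed

end

theory Submission
  imports Defs
begin

text \<open>
  The topology on the open subsets of Baire space is so coarse that Borel sets cannot decide the
  relation between a point and an open set to which it may belong, whereas names decide it
  at the level of open sets. A point \<open>x\<close> can be built into an open set: \<open>marked x\<close>
  consists of a clopen copy of Baire space, to which \<open>x\<close> belongs if \<open>x 0 = 0\<close>, and of further
  points that list the values of \<open>x\<close>. Removing the point \<open>x\<close> from it gives \<open>punctured x\<close>.

  Every open set \<open>U\<close> of open sets is Scott open (\<open>openin_opens_Scott\<close>): if the union of a sequence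
  of suitable clopen sets belongs to \<open>U\<close>, then so does every open set above some finite part of the
  union. If now \<open>marked y\<close> is in \<open>U\<close>, then finitely many values of \<open>y\<close> and a finite part of
  an exhaustion of the copy of Baire space are responsible for this. The exhaustion can be chosen
  such that every finite part of it leaves out a nonempty open set of points \<open>x\<close> that have these
  values in common with \<open>y\<close>. For these \<open>x\<close> also \<open>punctured x\<close> is in \<open>U\<close>. Hence the set of those
  \<open>x\<close> for which \<open>U\<close> does not distinguish the two open sets is comeager, and this property passes to complements and countable unions, hence to
  all Borel sets (\<open>comeager_indistinct_borel\<close>). By the Baire category theorem, no Borel set
  contains all \<open>marked x\<close> and no \<open>punctured x\<close> for \<open>x 0 = 0\<close>.

  The set \<open>selector_sets\<close> does exactly this. It expresses that the open set contains a point
  all of whose values are among those listed, or that the list of values is incomplete. The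
  second condition is \<open>\<Sigma>\<^sub>2\<close>. Where it fails, the first is open in the names: a cylinder inside
  the open set whose finitely many values are all listed can be prolonged to such a point
  (\<open>selector_sets_iff_names\<close>). What remains is to see that the finite conditions on initial
  segments of names are decidable in the sense of the given inductive notion of recursive
  function, for which bounded search through coded lists is developed first.
\<close>

section \<open>Recursive functions and decidable predicates\<close>

text \<open>
  The rules of \<^const>\<open>recursive_fun\<close> prescribe the values on lists of every length, although only
  those on lists of the declared arity are meaningful. Passing to functions that agree there
  makes it possible to replace a function by an equivalent expression.
\<close>

definition computable :: "nat \<Rightarrow> (nat list \<Rightarrow> nat) \<Rightarrow> bool" where
  "computable n f \<longleftrightarrow> (\<exists>g. recursive_fun n g \<and> (\<forall>xs. length xs = n \<longrightarrow> f xs = g xs))"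

definition decidable :: "nat \<Rightarrow> (nat list \<Rightarrow> bool) \<Rightarrow> bool" where
  "decidable n P \<longleftrightarrow> computable n (\<lambda>xs. of_bool (P xs))"

lemma computable_cong:
  "(\<And>xs. length xs = n \<Longrightarrow> f xs = g xs) \<Longrightarrow> computable n f \<longleftrightarrow> computable n g"
  unfolding computable_def by (metis (no_types))

lemma computable_recursive: "recursive_fun n f \<Longrightarrow> computable n f"
  unfolding computable_def by blast

lemma computable_proj: "i < n \<Longrightarrow> computable n (\<lambda>xs. xs ! i)"
  by (rule computable_recursive) (rule recursive_fun.proj)

lemma computable_comp:
  assumes "computable (length gs) f" "\<And>g. g \<in> set gs \<Longrightarrow> computable n g"
  shows "computable n (\<lambda>xs. f (map (\<lambda>g. g xs) gs))"
proof -
  obtain f' where f': "recursive_fun (length gs) f'" "\<And>xs. length xs = length gs \<Longrightarrow> f xs = f' xs"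
    using assms(1) unfolding computable_def by blast
  obtain r where r: "\<And>g. g \<in> set gs \<Longrightarrow> recursive_fun n (r g)"
    "\<And>g xs. g \<in> set gs \<Longrightarrow> length xs = n \<Longrightarrow> g xs = r g xs"
    using assms(2) unfolding computable_def by metis
  have "recursive_fun n (\<lambda>xs. f' (map (\<lambda>g. g xs) (map r gs)))"
    by (rule recursive_fun.comp) (use f' r in auto)
  moreover have "f (map (\<lambda>g. g xs) gs) = f' (map (\<lambda>g. g xs) (map r gs))" if "length xs = n" for xs
  proof -
    have "map (\<lambda>g. g xs) gs = map (\<lambda>g. g xs) (map r gs)"
      using r(2) that by simp
    then show ?thesis using f'(2)[of "map (\<lambda>g. g xs) gs"] by (metis length_map)
  qed
  ultimately show ?thesis unfolding computable_def by blast
qed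

lemma computable_Suc:
  assumes "computable n f"
  shows "computable n (\<lambda>xs. Suc (f xs))"
  using computable_comp[of "[f]" "\<lambda>xs. Suc (xs ! 0)" n] assms
    computable_recursive[OF recursive_fun.succ] by simp

lemma computable_const: "computable n (\<lambda>xs. c)"
  by (induction c) (auto intro: computable_Suc computable_recursive recursive_fun.zero)

lemma computable_weaken:
  assumes "computable n f"
  shows "computable (Suc n) (\<lambda>xs. f (tl xs))"
proof -
  have "computable (Suc n) (\<lambda>xs. f (map (\<lambda>g. g xs) (map (\<lambda>i xs. xs ! Suc i) [0..<n])))"
    by (rule computable_comp) (use assms in \<open>auto intro: computable_proj\<close>)
  moreover have "map (\<lambda>g. g xs) (map (\<lambda>i xs. xs ! Suc i) [0..<n]) = tl xs"
    if "length xs = Suc n" for xs :: "nat list"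
    by (rule nth_equalityI) (use that in \<open>auto simp: nth_tl\<close>)
  ultimately show ?thesis
    by (subst (asm) computable_cong[where g = "\<lambda>xs. f (tl xs)"]) auto
qed

text \<open>
  Primitive recursion and bounded search bind new leading arguments in front of the parameters.
  This lemma discards \<open>k\<close> of them and substitutes a computed value for the leading one.
\<close>

lemma computable_Cons_drop:
  assumes "computable (Suc n) f" "computable (k + n) b"
  shows "computable (k + n) (\<lambda>xs. f (b xs # drop k xs))"
proof -
  have "computable (k + n) (\<lambda>xs. f (map (\<lambda>g. g xs) (b # map (\<lambda>i xs. xs ! (k + i)) [0..<n])))"
    by (rule computable_comp) (use assms in \<open>auto intro: computable_proj\<close>)
  moreover have "map (\<lambda>g. g xs) (map (\<lambda>i xs. xs ! (k + i)) [0..<n]) = drop k xs"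
    if "length xs = k + n" for xs :: "nat list"
    by (rule nth_equalityI) (use that in auto)
  ultimately show ?thesis
    by (subst (asm) computable_cong[where g = "\<lambda>xs. f (b xs # drop k xs)"]) auto
qed

lemma computable_rec:
  assumes "computable n a" "computable (Suc (Suc n)) g" "computable n b"
  shows "computable n (\<lambda>xs. rec_nat (a xs) (\<lambda>y r. g (y # r # xs)) (b xs))"
proof -
  obtain a' where a': "recursive_fun n a'" "\<And>xs. length xs = n \<Longrightarrow> a xs = a' xs"
    using assms(1) unfolding computable_def by blast
  obtain g' where g': "recursive_fun (Suc (Suc n)) g'"
    "\<And>xs. length xs = Suc (Suc n) \<Longrightarrow> g xs = g' xs"
    using assms(2) unfolding computable_def by blast
  have "computable (Suc n)
      (\<lambda>xs. rec_nat (a' (tl xs)) (\<lambda>y r. g' (y # r # tl xs)) (hd xs))"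
    by (intro computable_recursive recursive_fun.prec a' g')
  from computable_Cons_drop[OF this, of 0 b] assms(3) show ?thesis
    by (subst computable_cong[where g = "\<lambda>xs. rec_nat (a' xs) (\<lambda>y r. g' (y # r # xs)) (b xs)"])
      (use a' g' in auto)
qed

lemma computable_Least:
  assumes "computable (Suc n) f" "\<And>xs. length xs = n \<Longrightarrow> \<exists>y. f (y # xs) = 0"
  shows "computable n (\<lambda>xs. LEAST y. f (y # xs) = 0)"
proof -
  obtain f' where f': "recursive_fun (Suc n) f'" "\<And>xs. length xs = Suc n \<Longrightarrow> f xs = f' xs"
    using assms(1) unfolding computable_def by blast
  have "recursive_fun n (\<lambda>xs. LEAST y. f' (y # xs) = 0)"
    by (rule recursive_fun.mini) (use f' assms(2) in \<open>auto\<close>)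
  then show ?thesis
    unfolding computable_def
    by (intro exI[of _ "\<lambda>xs. LEAST y. f' (y # xs) = 0"]) (simp add: f'(2))
qed

lemma computable_add:
  assumes "computable n f" "computable n g"
  shows "computable n (\<lambda>xs. f xs + g xs)"
proof -
  have "rec_nat a (\<lambda>_. Suc) b = a + b" for a b by (induction b) auto
  then show ?thesis
    using computable_rec[OF assms(1) _ assms(2), of "\<lambda>zs. Suc (zs ! 1)"]
    by (simp add: computable_Suc computable_proj)
qed

lemma computable_diff:
  assumes "computable n f" "computable n g"
  shows "computable n (\<lambda>xs. f xs - g xs)"
proof -
  have "computable n (\<lambda>xs. h xs - 1)" if "computable n h" for n h
  proof -
    have "rec_nat 0 (\<lambda>y _. y) c = c - 1" for c :: nat by (cases c) auto
    then show ?thesis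
      using computable_rec[OF computable_const[of n 0] _ that, of "\<lambda>zs. zs ! 0"]
      by (simp add: computable_proj)
  qed
  moreover have "rec_nat a (\<lambda>_ r. r - 1) b = a - b" for a b :: nat by (induction b) auto
  ultimately show ?thesis
    using computable_rec[OF assms(1) _ assms(2), of "\<lambda>zs. zs ! 1 - 1"]
    by (simp add: computable_proj)
qed

lemma computable_triangle:
  assumes "computable n f"
  shows "computable n (\<lambda>xs. triangle (f xs))"
proof -
  have "rec_nat 0 (\<lambda>y r. r + Suc y) c = triangle c" for c by (induction c) auto
  then show ?thesis
    using computable_rec[OF computable_const[of n 0] _ assms, of "\<lambda>zs. zs ! 1 + Suc (zs ! 0)"]
    by (simp add: computable_proj computable_add computable_Suc)
qed

lemma computable_prod_encode:
  "computable n f \<Longrightarrow> computable n g \<Longrightarrow> computable n (\<lambda>xs. prod_encode (f xs, g xs))"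
  unfolding prod_encode_def by (simp add: computable_add computable_triangle)

text \<open>
  The pair coded by \<open>c\<close> lies on the antidiagonal whose index \<open>k\<close> is the least number with
  \<open>c < triangle (Suc k)\<close>; its position there is \<open>c - triangle k\<close>.
\<close>

lemma prod_decode_eq_Least:
  defines "k \<equiv> \<lambda>c. LEAST k. Suc c - triangle (Suc k) = 0"
  shows "fst (prod_decode c) = c - triangle (k c)" "snd (prod_decode c) = triangle (k c) + k c - c"
proof -
  obtain a b where c: "c = prod_encode (a, b)" by (metis prod_decode_inverse surj_pair)
  have mono: "triangle i \<le> triangle j" if "i \<le> j" for i j
    using that by (induction rule: dec_induct) auto
  have "k c = a + b" unfolding k_def
  proof (rule Least_equality)
    show "Suc c - triangle (Suc (a + b)) = 0" by (simp add: c prod_encode_def)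
    show "a + b \<le> j" if "Suc c - triangle (Suc j) = 0" for j
    proof (rule ccontr)
      assume "\<not> a + b \<le> j"
      then have "triangle (Suc j) \<le> triangle (a + b)" by (intro mono) simp
      with that show False by (simp add: c prod_encode_def)
    qed
  qed
  then show "fst (prod_decode c) = c - triangle (k c)" "snd (prod_decode c) = triangle (k c) + k c - c"
    by (simp_all add: c) (simp_all add: prod_encode_def)
qed

lemma
  assumes f: "computable n f"
  shows computable_fst_prod_decode: "computable n (\<lambda>xs. fst (prod_decode (f xs)))"
    and computable_snd_prod_decode: "computable n (\<lambda>xs. snd (prod_decode (f xs)))"
proof -
  have ex: "\<exists>k. Suc c - triangle (Suc k) = 0" for c
    by (rule exI[of _ c]) simp
  have "computable n (\<lambda>xs. LEAST k. (\<lambda>zs. Suc (f (tl zs)) - triangle (Suc (zs ! 0))) (k # xs) = 0)"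
    by (rule computable_Least)
      (intro computable_diff computable_Suc computable_triangle computable_proj
        computable_weaken[OF f] zero_less_Suc, simp only: nth_Cons_0 list.sel ex)
  then have k: "computable n (\<lambda>xs. LEAST k. Suc (f xs) - triangle (Suc k) = 0)"
    by simp
  show "computable n (\<lambda>xs. fst (prod_decode (f xs)))" "computable n (\<lambda>xs. snd (prod_decode (f xs)))"
    unfolding prod_decode_eq_Least
    by (rule computable_diff computable_add computable_triangle k f)+
qed

text \<open>
  Lists are handled through their codes. A nonempty list has code \<open>Suc (prod_encode (head, tail))\<close>,
  and the pair coded by \<open>0\<close> is \<open>(0, 0)\<close>, so that the tail formula below is valid for \<open>[]\<close> too.
\<close>

lemma prod_decode_0: "prod_decode 0 = (0, 0)"
  by (simp add: prod_decode_def prod_decode_aux.simps)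

lemma list_encode_tl: "list_encode (tl (list_decode c)) = snd (prod_decode (c - 1))"
  by (cases c) (auto simp: prod_decode_0 split: prod.split)

lemma list_encode_drop:
  "list_encode (drop i (list_decode c)) = rec_nat c (\<lambda>_ r. snd (prod_decode (r - 1))) i"
proof (induction i)
  case (Suc i)
  have "list_encode (drop (Suc i) (list_decode c)) =
      list_encode (tl (list_decode (list_encode (drop i (list_decode c)))))"
    by (simp add: drop_Suc tl_drop)
  also have "\<dots> = snd (prod_decode (list_encode (drop i (list_decode c)) - 1))"
    by (rule list_encode_tl)
  finally show ?case by (simp add: Suc)
qed simp

lemma computable_drop:
  assumes "computable n f" "computable n g"
  shows "computable n (\<lambda>xs. list_encode (drop (g xs) (list_decode (f xs))))"
  unfolding list_encode_drop
  using computable_rec[OF assms(1) _ assms(2), of "\<lambda>zs. snd (prod_decode (zs ! 1 - 1))"]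
  by (simp add: computable_snd_prod_decode computable_diff computable_proj computable_const)

lemma computable_nth:
  assumes "computable n f" "computable n g"
  shows "computable n (\<lambda>xs. nth_default 0 (list_decode (f xs)) (g xs))"
proof -
  have hd: "fst (prod_decode (list_encode l - 1)) = nth_default 0 l 0" for l
    by (cases l) (auto simp: prod_decode_0)
  have "nth_default 0 l i = nth_default 0 (drop i l) 0" for l :: "nat list" and i
    by (simp add: nth_default_def)
  then have eq: "nth_default 0 l i = fst (prod_decode (list_encode (drop i l) - 1))" for l i
    by (metis hd)
  show ?thesis unfolding eq
    by (intro computable_fst_prod_decode computable_diff computable_drop computable_const assms)
qed

lemma computable_length:
  assumes f: "computable n f"
  shows "computable n (\<lambda>xs. length (list_decode (f xs)))"
proof -
  have 0: "list_encode (drop i l) = 0 \<longleftrightarrow> length l \<le> i" for i l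
    by (metis drop_eq_Nil list_encode.simps(1) list_encode_eq)
  have "computable n (\<lambda>xs. LEAST i. (\<lambda>zs. list_encode (drop (zs ! 0) (list_decode (f (tl zs))))) (i # xs) = 0)"
    by (rule computable_Least)
      (use 0 in \<open>auto intro!: computable_drop computable_proj computable_weaken[OF f]\<close>)
  moreover have "(LEAST i. length l \<le> i) = length l" for l :: "nat list"
    by (rule Least_equality) auto
  ultimately show ?thesis by (simp add: 0)
qed

lemma decidable_cong:
  "(\<And>xs. length xs = n \<Longrightarrow> P xs \<longleftrightarrow> Q xs) \<Longrightarrow> decidable n P \<longleftrightarrow> decidable n Q"
  unfolding decidable_def by (rule computable_cong) simp

lemma decidable_not:
  assumes "decidable n P"
  shows "decidable n (\<lambda>xs. \<not> P xs)"
proof -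
  have "(of_bool (\<not> P xs) :: nat) = 1 - of_bool (P xs)" for xs by simp
  then show ?thesis
    using assms unfolding decidable_def by (simp only:) (intro computable_diff computable_const)
qed

lemma decidable_le:
  assumes "computable n f" "computable n g"
  shows "decidable n (\<lambda>xs. f xs \<le> g xs)"
proof -
  have "(of_bool (f xs \<le> g xs) :: nat) = 1 - (f xs - g xs)" for xs by auto
  then show ?thesis
    unfolding decidable_def by (simp only:) (intro computable_diff computable_const assms)
qed

lemma decidable_or:
  assumes "decidable n P" "decidable n Q"
  shows "decidable n (\<lambda>xs. P xs \<or> Q xs)"
proof -
  have "decidable n (\<lambda>xs. 1 \<le> (of_bool (P xs) + of_bool (Q xs) :: nat))"
    by (intro decidable_le computable_const computable_add) (use assms in \<open>auto simp: decidable_def\<close>)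
  then show ?thesis by (rule decidable_cong[THEN iffD1, rotated]) auto
qed

lemma decidable_and:
  assumes "decidable n P" "decidable n Q"
  shows "decidable n (\<lambda>xs. P xs \<and> Q xs)"
  using decidable_not[OF decidable_or[OF decidable_not[OF assms(1)] decidable_not[OF assms(2)]]]
  by simp

lemma decidable_imp:
  assumes "decidable n P" "decidable n Q"
  shows "decidable n (\<lambda>xs. P xs \<longrightarrow> Q xs)"
  unfolding imp_conv_disj by (intro decidable_or decidable_not assms)

lemma decidable_less:
  assumes "computable n f" "computable n g"
  shows "decidable n (\<lambda>xs. f xs < g xs)"
  unfolding not_le[symmetric] by (intro decidable_not decidable_le assms)

lemma decidable_eq:
  assumes "computable n f" "computable n g"
  shows "decidable n (\<lambda>xs. f xs = g xs)"
  unfolding eq_iff[of "f _"] by (intro decidable_and decidable_le assms)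

text \<open>
  A bounded search is the primitive recursion that remembers whether a witness occurred so far.
\<close>

lemma decidable_bex_less:
  assumes b: "computable n b" and P: "decidable (Suc n) (\<lambda>ys. P (ys ! 0) (tl ys))"
  shows "decidable n (\<lambda>xs. \<exists>i < b xs. P i xs)"
proof -
  have "decidable (Suc (Suc n)) (\<lambda>zs. P (zs ! 0) (tl (tl zs)))"
    using computable_Cons_drop[OF P[unfolded decidable_def], of 2 "\<lambda>zs. zs ! 0"]
    by (simp add: decidable_def computable_proj numeral_2_eq_2 drop_Suc)
  then have "decidable (Suc (Suc n)) (\<lambda>zs. 0 < zs ! 1 \<or> P (zs ! 0) (tl (tl zs)))"
    by (intro decidable_or decidable_less computable_const computable_proj) auto
  from computable_rec[OF computable_const[of n 0] this[unfolded decidable_def] b]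
  have "computable n (\<lambda>xs. rec_nat 0 (\<lambda>y r. of_bool (0 < r \<or> P y xs)) (b xs))"
    by simp
  moreover have "rec_nat 0 (\<lambda>y r. of_bool (0 < r \<or> P y xs)) m = (of_bool (\<exists>i<m. P i xs) :: nat)"
    for m xs
    by (induction m) (auto simp: less_Suc_eq)
  ultimately show ?thesis unfolding decidable_def by simp
qed

lemma decidable_ball_less:
  assumes "computable n b" "decidable (Suc n) (\<lambda>ys. P (ys ! 0) (tl ys))"
  shows "decidable n (\<lambda>xs. \<forall>i < b xs. P i xs)"
  using decidable_not[OF decidable_bex_less[OF assms(1) decidable_not[OF assms(2)]]] by simp

text \<open>
  With this rule a search through a coded list has the same shape as its mathematical
  description, and positions disappear. The bound element is the leading argument.
\<close>

lemma decidable_bex_set: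
  assumes f: "computable n f" and P: "decidable (Suc n) (\<lambda>ys. P (ys ! 0) (tl ys))"
  shows "decidable n (\<lambda>xs. \<exists>a \<in> set (list_decode (f xs)). P a xs)"
proof -
  have "computable (Suc n) (\<lambda>ys. nth_default 0 (list_decode (f (tl ys))) (ys ! 0))"
    by (intro computable_nth computable_weaken[OF f] computable_proj) simp
  then have "decidable (Suc n) (\<lambda>ys. P (nth_default 0 (list_decode (f (tl ys))) (ys ! 0)) (tl ys))"
    using computable_Cons_drop[OF P[unfolded decidable_def], of 1]
    by (simp add: decidable_def drop_Suc)
  then have "decidable n (\<lambda>xs. \<exists>i < length (list_decode (f xs)).
      P (nth_default 0 (list_decode (f xs)) i) xs)"
    by (intro decidable_bex_less computable_length f)
  moreover have "(\<exists>a \<in> set l. R a) \<longleftrightarrow> (\<exists>i < length l. R (nth_default 0 l i))" for l :: "nat list" and R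
    unfolding set_conv_nth by (auto simp: nth_default_nth)
  ultimately show ?thesis by (simp only:)
qed

section \<open>Names of open sets and Scott continuity\<close>

text \<open>
  The representation of open sets, freed from characteristic functions: only the realizer into
  Baire space matters, and the open set is where its output is not constantly zero.
\<close>

lemma opens_eq_Some_iff:
  "opens baire_space p = Some P \<longleftrightarrow>
     (\<exists>F. continuous_on UNIV F \<and> (\<forall>x. evaluates p x (F x)) \<and> P = {x. F x \<noteq> (\<lambda>_. 0)})"
proof -
  have "opens baire_space p = Some P \<longleftrightarrow>
      (\<exists>f. is_name_of_fun baire_space sierpinski p f \<and> P = Collect f)"
    by (auto simp: opens_def fun_space_eq_Some_iff)
  also have "\<dots> \<longleftrightarrow> (\<exists>f F. continuous_on UNIV F \<and> (\<forall>x. f x \<longleftrightarrow> F x \<noteq> (\<lambda>_. 0)) \<and>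
      (\<forall>x. evaluates p x (F x)) \<and> P = Collect f)"
    unfolding is_name_of_fun_def continuous_realizer_baire_sierpinski by auto
  also have "\<dots> \<longleftrightarrow>
      (\<exists>F. continuous_on UNIV F \<and> (\<forall>x. evaluates p x (F x)) \<and> P = {x. F x \<noteq> (\<lambda>_. 0)})"
    by auto
  finally show ?thesis .
qed

text \<open>
  An entry of a name is the code of a pair \<open>(u, v)\<close>. It carries positive information, namely that
  the cylinder \<open>u\<close>, its guard, is contained in the open set, exactly if \<open>v\<close> has a nonzero entry.
\<close>

definition guard :: "nat \<Rightarrow> nat list" where
  "guard e = list_decode (fst (prod_decode e))"

definition affirmative :: "nat \<Rightarrow> bool" where
  "affirmative e \<longleftrightarrow> (\<exists>a \<in> set (list_decode (snd (prod_decode e))). a \<noteq> 0)"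

text \<open>
  This is the link to the usual representation of open sets by enumerations of cylinders. An
  affirmative entry forces a nonzero output value, and a nonzero output value must be announced
  by some entry, because the entries determine arbitrarily long parts of the output.
\<close>

lemma mem_iff_affirmative_entry:
  assumes "opens baire_space p = Some P"
  shows "x \<in> P \<longleftrightarrow> (\<exists>k. affirmative (p k) \<and> x \<in> cylinder (guard (p k)))"
proof -
  obtain F where F: "evaluates p x (F x)" and P: "P = {x. F x \<noteq> (\<lambda>_. 0)}"
    using assms unfolding opens_eq_Some_iff by blast
  show ?thesis
  proof
    assume "x \<in> P"
    then obtain n where n: "F x n \<noteq> 0" by (auto simp: P)
    obtain u v where uv: "lists_pair p u v" "x \<in> cylinder u" "Suc n \<le> length v"
      using F unfolding evaluates_def by blast
    then have "F x \<in> cylinder v" using F unfolding evaluates_def by blast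
    then have "v ! n \<noteq> 0" "v ! n \<in> set v" using n uv(3) by (auto simp: cylinder_iff)
    moreover obtain k where "p k = prod_encode (list_encode u, list_encode v)"
      using uv(1) unfolding lists_pair_def by blast
    ultimately show "\<exists>k. affirmative (p k) \<and> x \<in> cylinder (guard (p k))"
      using uv(2) by (intro exI[of _ k]) (auto simp: affirmative_def guard_def)
  next
    assume "\<exists>k. affirmative (p k) \<and> x \<in> cylinder (guard (p k))"
    then obtain k where k: "affirmative (p k)" "x \<in> cylinder (guard (p k))" by blast
    define v where "v = list_decode (snd (prod_decode (p k)))"
    have "lists_pair p (guard (p k)) v"
      unfolding lists_pair_def guard_def v_def by (intro exI[of _ k]) simp
    then have "F x \<in> cylinder v" using k(2) F unfolding evaluates_def by blast
    moreover obtain i where "i < length v" "v ! i \<noteq> 0"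
      using k(1) unfolding affirmative_def v_def[symmetric] by (metis in_set_conv_nth)
    ultimately have "F x i \<noteq> 0" by (simp add: cylinder_iff)
    then show "x \<in> P" by (auto simp: P)
  qed
qed

text \<open>
  Sets for which membership depends on a fixed number of coordinates. They are clopen, so that the
  function \<open>stage\<close> below is continuous; unions of sequences of them are exactly the open sets.
\<close>

definition finitary :: "baire set \<Rightarrow> bool" where
  "finitary C \<longleftrightarrow> (\<exists>k. \<forall>x y. (\<forall>i<k. x i = y i) \<longrightarrow> (x \<in> C \<longleftrightarrow> y \<in> C))"

lemma finitary_cylinder_subset: "finitary {x. cylinder (init_seg x n) \<subseteq> P}"
proof -
  have "init_seg x n = init_seg y n" if "\<forall>i<n. x i = y i" for x y
    using that by (simp add: init_seg_def)
  then show ?thesis unfolding finitary_def mem_Collect_eq by (metis (no_types))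
qed

lemma finitary_imp_open:
  assumes "finitary C"
  shows "open C"
proof -
  obtain k where k: "\<And>x y. (\<forall>i<k. x i = y i) \<Longrightarrow> (x \<in> C \<longleftrightarrow> y \<in> C)"
    using assms unfolding finitary_def by blast
  have "C = (\<Union>x\<in>C. cylinder (init_seg x k))"
  proof (intro equalityI subsetI)
    show "x \<in> (\<Union>x\<in>C. cylinder (init_seg x k))" if "x \<in> C" for x
      using that by (intro UN_I[of x]) (simp_all add: mem_cylinder_init_seg)
    show "x \<in> C" if "x \<in> (\<Union>x\<in>C. cylinder (init_seg x k))" for x
      using that k[of x] unfolding mem_cylinder_init_seg UN_iff by blast
  qed
  moreover have "open (\<Union>x\<in>C. cylinder (init_seg x k))"
    by (intro open_UN ballI open_cylinder)
  ultimately show ?thesis by simp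
qed

lemma open_eq_UN_finitary:
  assumes "open P"
  shows "P = (\<Union>n. {x. cylinder (init_seg x n) \<subseteq> P})"
proof (intro equalityI subsetI)
  show "x \<in> (\<Union>n. {x. cylinder (init_seg x n) \<subseteq> P})" if "x \<in> P" for x
    using open_contains_cylinder[OF assms that] by blast
  show "x \<in> P" if "x \<in> (\<Union>n. {x. cylinder (init_seg x n) \<subseteq> P})" for x
    using that mem_cylinder_init_seg by blast
qed

text \<open>
  A realizer of the open set \<open>\<Union>i. C i\<close> that reports membership in \<open>C i\<close> not before output
  position \<open>i\<close>. Its first \<open>N\<close> output values only depend on \<open>C 0, \<dots>, C (N - 1)\<close>.
\<close>

definition stage :: "(nat \<Rightarrow> baire set) \<Rightarrow> baire \<Rightarrow> baire" where
  "stage C x n = of_bool (\<exists>i\<le>n. x \<in> C i)"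

text \<open>
  The largest set of entries that a name of a realizer \<open>F\<close> may contain. Enumerating all of it
  gives a name if \<open>F\<close> is continuous.
\<close>

definition valid_entries :: "(baire \<Rightarrow> baire) \<Rightarrow> nat set" where
  "valid_entries F =
     {prod_encode (list_encode u, list_encode v) |u v. F ` cylinder u \<subseteq> cylinder v}"

lemma continuous_stage:
  assumes "\<And>i. finitary (C i)"
  shows "continuous_on UNIV (stage C)"
proof (rule continuous_on_coordinatewise_then_product)
  fix n
  define E where "E = (\<Union>i\<le>n. C i)"
  obtain k where k: "\<And>i x y. (\<forall>j<k i. x j = y j) \<Longrightarrow> (x \<in> C i \<longleftrightarrow> y \<in> C i)"
    using assms unfolding finitary_def by metis
  have "finitary E" unfolding finitary_def
  proof (intro exI[of _ "\<Sum>i\<le>n. k i"] allI impI)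
    fix x y :: baire assume xy: "\<forall>j<\<Sum>i\<le>n. k i. x j = y j"
    have "x \<in> C i \<longleftrightarrow> y \<in> C i" if "i \<le> n" for i
    proof (rule k, intro allI impI)
      fix j assume "j < k i"
      also have "k i \<le> (\<Sum>i\<le>n. k i)" using that by (intro member_le_sum) auto
      finally show "x j = y j" using xy by blast
    qed
    then show "x \<in> E \<longleftrightarrow> y \<in> E" by (auto simp: E_def)
  qed
  moreover from this have "finitary (- E)" by (simp add: finitary_def)
  ultimately have E: "open E" "open (- E)" by (simp_all add: finitary_imp_open)
  have "stage C x n = (if x \<in> E then 1 else 0)" for x by (auto simp: stage_def E_def)
  then have "(\<lambda>x. stage C x n) -` B = (if 1 \<in> B then E else {}) \<union> (if 0 \<in> B then - E else {})" for B
    by (auto split: if_splits)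
  then have "open ((\<lambda>x. stage C x n) -` B)" for B
    using E by auto
  then show "continuous_on UNIV (\<lambda>x. stage C x n)"
    by (simp add: continuous_on_open_vimage)
qed

lemma opens_valid_entries:
  assumes C: "\<And>i. finitary (C i)" and p: "range p = valid_entries (stage C)"
  shows "opens baire_space p = Some (\<Union>i. C i)"
  unfolding opens_eq_Some_iff
proof (intro exI[of _ "stage C"] conjI allI continuous_stage C)
  let ?F = "stage C"
  show "(\<Union>i. C i) = {x. stage C x \<noteq> (\<lambda>_. 0)}"
    by (auto simp: fun_eq_iff stage_def)
  fix x
  have p: "lists_pair p u v \<longleftrightarrow> ?F ` cylinder u \<subseteq> cylinder v" for u v
  proof -
    have "lists_pair p u v \<longleftrightarrow> prod_encode (list_encode u, list_encode v) \<in> range p"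
      unfolding lists_pair_def image_iff by (auto simp: eq_commute)
    then show ?thesis unfolding p by (auto simp: valid_entries_def list_encode_eq)
  qed
  show "evaluates p x (?F x)"
    unfolding evaluates_def
  proof (intro conjI allI impI)
    show "?F x \<in> cylinder v" if "lists_pair p u v \<and> x \<in> cylinder u" for u v
      using that p by blast
    fix n
    have "continuous_on UNIV ?F" by (rule continuous_stage[OF C])
    then have "open (?F -` cylinder (init_seg (?F x) n))"
      by (rule open_vimage[OF open_cylinder])
    moreover have "x \<in> ?F -` cylinder (init_seg (?F x) n)"
      by (simp add: mem_cylinder_init_seg)
    ultimately obtain k where "cylinder (init_seg x k) \<subseteq> ?F -` cylinder (init_seg (?F x) n)"
      using open_contains_cylinder by blast
    then have "lists_pair p (init_seg x k) (init_seg (?F x) n)" unfolding p by blast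
    then show "\<exists>u v. lists_pair p u v \<and> x \<in> cylinder u \<and> n \<le> length v"
      by (metis length_init_seg mem_cylinder_init_seg order_refl)
  qed
qed

lemma ex_range_valid_entries: "\<exists>q :: baire. range q = valid_entries F"
proof -
  have "cylinder [] = UNIV" by (simp add: cylinder_def init_seg_def)
  then have "valid_entries F \<noteq> {}" unfolding valid_entries_def by blast
  then have "range (from_nat_into (valid_entries F)) = valid_entries F"
    by (intro range_from_nat_into) auto
  then show ?thesis by (rule exI[of _ "from_nat_into (valid_entries F)"])
qed

text \<open>
  Sets that are open in the final topology are Scott open. Openness only inspects a finite part of
  a name of \<open>\<Union>i. C i\<close>. The entries in that part speak about finitely many output positions of the
  realizer \<^term>\<open>stage C\<close>, say those below \<open>N\<close>, and these involve only the first \<open>N\<close> of the sets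
  \<open>C i\<close>. Replacing the later sets by finitary sets that exhaust \<open>P\<close> leaves the entries valid, so the
  finite part extends to a name of \<open>P\<close>.
\<close>

lemma openin_opens_Scott:
  fixes C :: "nat \<Rightarrow> baire set"
  assumes U: "openin (rep_topology (opens baire_space)) U"
    and C: "\<And>i. finitary (C i)" and "(\<Union>i. C i) \<in> U"
  obtains N where "\<And>P. open P \<Longrightarrow> (\<Union>i<N. C i) \<subseteq> P \<Longrightarrow> P \<in> U"
proof -
  let ?\<delta> = "opens baire_space"
  obtain p :: baire where p: "range p = valid_entries (stage C)" using ex_range_valid_entries by blast
  obtain T where T: "open T" "{q \<in> dom ?\<delta>. the (?\<delta> q) \<in> U} = dom ?\<delta> \<inter> T"
    using U unfolding openin_rep_topology openin_open by blast
  have "?\<delta> p = Some (\<Union>i. C i)" by (rule opens_valid_entries[OF C p])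
  then have "p \<in> T" using T(2) assms(3) by (auto simp: dom_def)
  then obtain k where k: "cylinder (init_seg p k) \<subseteq> T"
    using T(1) open_contains_cylinder by blast
  define N where "N = (\<Sum>i<k. length (list_decode (snd (prod_decode (p i)))))"
  have "P \<in> U" if P: "open P" "(\<Union>i<N. C i) \<subseteq> P" for P
  proof -
    define C' where "C' i = (if i < N then C i else {x. cylinder (init_seg x i) \<subseteq> P})" for i
    have C': "finitary (C' i)" for i
      by (simp add: C'_def C finitary_cylinder_subset)
    obtain q :: baire where q: "range q = valid_entries (stage C')" using ex_range_valid_entries by blast
    define p' where "p' i = (if i < k then p i else q (i - k))" for i
    have stage_eq: "stage C' x n = stage C x n" if "n < N" for x n
    proof -
      have "C' i = C i" if "i \<le> n" for i
        using that \<open>n < N\<close> by (simp add: C'_def)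
      then show ?thesis by (simp add: stage_def cong: conj_cong)
    qed
    have "p i \<in> valid_entries (stage C')" if "i < k" for i
    proof -
      have "p i \<in> valid_entries (stage C)" using p by blast
      then obtain u v where uv: "p i = prod_encode (list_encode u, list_encode v)"
        "stage C ` cylinder u \<subseteq> cylinder v"
        by (auto simp: valid_entries_def)
      have "length v = length (list_decode (snd (prod_decode (p i))))" by (simp add: uv)
      also have "\<dots> \<le> N" unfolding N_def using that by (intro member_le_sum) auto
      finally have "stage C' x \<in> cylinder v \<longleftrightarrow> stage C x \<in> cylinder v" for x
        by (simp add: cylinder_iff stage_eq)
      then have "stage C' ` cylinder u \<subseteq> cylinder v" using uv(2) by blast
      then show ?thesis using uv(1) unfolding valid_entries_def by blast
    qed
    then have "range p' \<subseteq> valid_entries (stage C')"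
      unfolding p'_def q[symmetric] by auto
    moreover have "range q \<subseteq> range p'"
    proof (rule image_subsetI)
      show "q j \<in> range p'" for j
        by (rule range_eqI[of _ _ "k + j"]) (simp add: p'_def)
    qed
    ultimately have "range p' = valid_entries (stage C')"
      unfolding q by (rule equalityI)
    then have "?\<delta> p' = Some (\<Union>i. C' i)" by (rule opens_valid_entries[OF C'])
    moreover have "(\<Union>i. C' i) = P"
    proof (intro equalityI subsetI)
      show "x \<in> P" if "x \<in> (\<Union>i. C' i)" for x
        using that P(2) mem_cylinder_init_seg[of x x] by (auto simp: C'_def split: if_splits)
      fix x assume "x \<in> P"
      then obtain j where j: "cylinder (init_seg x j) \<subseteq> P"
        using P(1) open_contains_cylinder by blast
      have "cylinder (init_seg x (N + j)) \<subseteq> cylinder (init_seg x j)"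
        by (auto simp: mem_cylinder_init_seg)
      then have "x \<in> C' (N + j)" using j by (auto simp: C'_def)
      then show "x \<in> (\<Union>i. C' i)" by blast
    qed
    ultimately have "?\<delta> p' = Some P" by simp
    moreover have "p' \<in> T" using k by (auto simp: mem_cylinder_init_seg p'_def)
    ultimately have "p' \<in> {q \<in> dom ?\<delta>. the (?\<delta> q) \<in> U}" unfolding T(2) by blast
    with \<open>?\<delta> p' = Some P\<close> show ?thesis by simp
  qed
  then show ?thesis by (rule that)
qed

text \<open>
  A consequence of Scott openness, applied to an exhaustion of \<open>P\<close> itself.
\<close>

lemma openin_opens_upward_closed:
  assumes U: "openin (rep_topology (opens baire_space)) U" and "P \<in> U" "P \<subseteq> P'" "open P'"
  shows "P' \<in> U"
proof -
  have "open P"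
    using openin_subset[OF U] \<open>P \<in> U\<close> by (auto simp: topspace_rep_topology ran_opens_baire_space)
  let ?C = "\<lambda>n. {x. cylinder (init_seg x n) \<subseteq> P}"
  have "(\<Union>n. ?C n) \<in> U" using \<open>P \<in> U\<close> open_eq_UN_finitary[OF \<open>open P\<close>] by simp
  then obtain N where N: "\<And>P'. open P' \<Longrightarrow> (\<Union>n<N. ?C n) \<subseteq> P' \<Longrightarrow> P' \<in> U"
    by (rule openin_opens_Scott[OF U finitary_cylinder_subset]) rule
  have "(\<Union>n<N. ?C n) \<subseteq> P'"
    using open_eq_UN_finitary[OF \<open>open P\<close>] \<open>P \<subseteq> P'\<close> by blast
  with \<open>open P'\<close> show ?thesis by (rule N)
qed

section \<open>Baire category\<close>

definition comeager :: "'a::topological_space set \<Rightarrow> bool" where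
  "comeager C \<longleftrightarrow> (\<exists>\<G>. countable \<G> \<and> (\<forall>G\<in>\<G>. open G \<and> closure G = UNIV) \<and> \<Inter>\<G> \<subseteq> C)"

lemma comeager_mono: "comeager C \<Longrightarrow> C \<subseteq> D \<Longrightarrow> comeager D"
  unfolding comeager_def by (meson order_trans)

lemma comeager_INT:
  fixes C :: "nat \<Rightarrow> 'a::topological_space set"
  assumes "\<And>i. comeager (C i)"
  shows "comeager (\<Inter>i. C i)"
proof -
  obtain \<G> where \<G>: "\<And>i. countable (\<G> i)" "\<And>i. \<forall>G\<in>\<G> i. open G \<and> closure G = UNIV"
    "\<And>i. \<Inter>(\<G> i) \<subseteq> C i"
    using assms unfolding comeager_def by metis
  have "countable (\<Union>i. \<G> i)" using \<G>(1) by simp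
  moreover have "\<forall>G\<in>(\<Union>i. \<G> i). open G \<and> closure G = UNIV" using \<G>(2) by simp
  moreover have "\<Inter>(\<Union>i. \<G> i) \<subseteq> (\<Inter>i. C i)"
  proof (rule INF_greatest)
    show "\<Inter>(\<Union>i. \<G> i) \<subseteq> C i" for i
      by (rule order_trans[OF _ \<G>(3)]) (rule Inter_anti_mono, blast)
  qed
  ultimately show ?thesis unfolding comeager_def by blast
qed

text \<open>
  Baire space is a product of countably many discrete, hence completely metrizable, spaces. The
  Baire category theorem therefore applies.
\<close>

lemma comeager_meets_open:
  fixes C V :: "baire set"
  assumes "comeager C" "open V" "V \<noteq> {}"
  shows "C \<inter> V \<noteq> {}"
proof -
  obtain \<G> where \<G>: "countable \<G>" "\<forall>G\<in>\<G>. open G \<and> closure G = UNIV" "\<Inter>\<G> \<subseteq> C"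
    using assms(1) unfolding comeager_def by blast
  have "(euclidean :: nat topology) = discrete_topology UNIV"
    by (simp add: topology_eq open_discrete)
  then have "completely_metrizable_space (euclidean :: baire topology)"
    unfolding euclidean_product_topology[symmetric] completely_metrizable_space_product_topology
    by (auto intro: completely_metrizable_space_discrete_topology)
  then have "euclidean closure_of \<Inter>\<G> = topspace (euclidean :: baire topology)"
    by (intro Baire_category) (use \<G> in auto)
  then have "closure (\<Inter>\<G>) = UNIV" by simp
  then have "\<Inter>\<G> \<inter> V \<noteq> {}"
    using open_Int_closure_eq_empty[OF assms(2), of "\<Inter>\<G>"] assms(3) by auto
  then show ?thesis using \<G>(3) by blast
qed

text \<open>
  The hypothesis says that \<open>C\<close> has dense interior.
\<close>

lemma comeager_if_cylinders:
  fixes C :: "baire set"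
  assumes "\<And>x k. \<exists>y j. cylinder (init_seg y j) \<subseteq> C \<inter> cylinder (init_seg x k)"
  shows "comeager C"
  unfolding comeager_def
proof (intro exI[of _ "{interior C}"] conjI ballI)
  show "\<Inter>{interior C} \<subseteq> C" by (simp add: interior_subset)
  show "open G" if "G \<in> {interior C}" for G using that by simp
  have "x \<in> closure (interior C)" for x
    unfolding closure_iff_nhds_not_empty
  proof (intro allI impI)
    fix A V assume V: "V \<subseteq> A" "open V" "x \<in> V"
    obtain k where k: "cylinder (init_seg x k) \<subseteq> V"
      using open_contains_cylinder[OF V(2,3)] by (elim exE)
    obtain y j where y: "cylinder (init_seg y j) \<subseteq> C \<inter> cylinder (init_seg x k)"
      using assms by (metis (no_types))
    then have "cylinder (init_seg y j) \<subseteq> interior C"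
      by (intro interior_maximal open_cylinder) simp
    moreover have "y \<in> cylinder (init_seg y j)" by (simp add: mem_cylinder_init_seg)
    ultimately have "y \<in> interior C" "y \<in> A" using y k V(1) by (simp_all add: subset_iff)
    then show "interior C \<inter> A \<noteq> {}" by (simp add: disjoint_iff) metis
  qed
  then show "closure G = UNIV" if "G \<in> {interior C}" for G using that by auto
qed simp

section \<open>A set of open sets that is not Borel\<close>

text \<open>
  The sets \<open>marked x\<close> and \<open>punctured x\<close> are the two open sets that Borel sets cannot tell apart.
  Points with first coordinate zero form a copy of Baire space; points with first coordinate
  \<open>n > 0\<close> store the value \<open>x n\<close>, so that \<open>x\<close> can be recovered from either of the sets. Both sets
  are used for \<open>x 0 = 0\<close>, when \<open>x\<close> itself is a point of that copy.
\<close>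

definition marked :: "baire \<Rightarrow> baire set" where
  "marked x = {z. z 0 = 0 \<or> z 1 = x (z 0)}"

definition punctured :: "baire \<Rightarrow> baire set" where
  "punctured x = marked x - {x}"

lemma open_marked: "open (marked x)"
proof (rule finitary_imp_open)
  show "finitary (marked x)"
    unfolding finitary_def marked_def by (intro exI[of _ 2]) auto
qed

lemma open_punctured: "open (punctured x)"
proof -
  have eq: "- {x} = (\<Union>i. (\<lambda>z. z i) -` (- {x i}))"
    by (rule set_eqI) (simp add: fun_eq_iff)
  have "open ((\<lambda>z::baire. z i) -` (- {x i}))" for i
    using open_discrete continuous_on_product_coordinates by (rule open_vimage)
  then have "open (- {x})" unfolding eq by (intro open_UN ballI)
  then show ?thesis
    unfolding punctured_def Diff_eq by (intro open_Int open_marked)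
qed

text \<open>
  Scott openness is used twice. It first yields a number \<open>M\<close> such that the values of \<open>y\<close> below \<open>M\<close>
  together with the whole zero part force membership in \<open>U\<close>. The zero part is then exhausted
  according to the size of the coordinate \<open>N\<close>, where \<open>N\<close> exceeds \<open>M\<close> and \<open>k\<close>: the points with
  \<open>z N < m\<close> suffice for some \<open>m\<close>. If \<open>x\<close> agrees with \<open>y\<close> below \<open>N\<close> and has \<open>x N = m\<close>, then \<open>x\<close> is
  not among these points, so removing it does no harm. The order of the choices matters: \<open>N\<close>
  comes after the values of \<open>y\<close> that have to be kept, so that every cylinder prescribing only
  these values contains points outside any finite union of the exhausting sets.
\<close>

lemma punctured_mem_generic:
  assumes U: "openin (rep_topology (opens baire_space)) U"
    and y: "y 0 = 0" "marked y \<in> U"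
  shows "\<exists>y' j. cylinder (init_seg y' j) \<subseteq> {x. punctured x \<in> U} \<inter> cylinder (init_seg y k)"
proof -
  define C :: "nat \<Rightarrow> baire set" where "C i = {z. z 0 \<le> i \<and> (z 0 = 0 \<or> z 1 = y (z 0))}" for i
  have "finitary (C i)" for i
    unfolding finitary_def C_def by (intro exI[of _ 2]) auto
  moreover have "(\<Union>i. C i) = marked y" by (auto simp: C_def marked_def)
  then have "(\<Union>i. C i) \<in> U" using y(2) by simp
  ultimately obtain M where M: "\<And>P. open P \<Longrightarrow> (\<Union>i<M. C i) \<subseteq> P \<Longrightarrow> P \<in> U"
    by (rule openin_opens_Scott[OF U]) rule
  define N where "N = M + k + 1"
  define E :: "nat \<Rightarrow> baire set" where "E i = {z. z 0 < N \<and> (if z 0 = 0 then z N \<le> i else z 1 = y (z 0))}" for i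
  have fin: "finitary (E i)" for i
    unfolding finitary_def E_def by (intro exI[of _ "N + 2"]) auto
  have "(\<Union>i. E i) \<in> U"
  proof (rule M)
    show "open (\<Union>i. E i)" by (intro open_UN ballI finitary_imp_open fin)
    show "(\<Union>i<M. C i) \<subseteq> (\<Union>i. E i)"
    proof
      fix z assume "z \<in> (\<Union>i<M. C i)"
      then have "z \<in> E (z N)" by (auto simp: C_def E_def N_def)
      then show "z \<in> (\<Union>i. E i)" by blast
    qed
  qed
  with fin obtain m where m: "\<And>P. open P \<Longrightarrow> (\<Union>i<m. E i) \<subseteq> P \<Longrightarrow> P \<in> U"
    by (rule openin_opens_Scott[OF U]) rule
  define y' where "y' = y(N := m)"
  have "punctured x \<in> U \<and> x \<in> cylinder (init_seg y k)"
    if "x \<in> cylinder (init_seg y' (Suc N))" for x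
  proof
    have x: "x i = y i" if "i < N" for i
      using \<open>x \<in> _\<close> that by (auto simp: mem_cylinder_init_seg y'_def)
    have xN: "x N = m" using that by (auto simp: mem_cylinder_init_seg y'_def)
    have "x 0 = 0" using x[of 0] y(1) by (simp add: N_def)
    show "x \<in> cylinder (init_seg y k)" using x by (simp add: mem_cylinder_init_seg N_def)
    show "punctured x \<in> U"
    proof (rule m)
      show "open (punctured x)" by (rule open_punctured)
      show "(\<Union>i<m. E i) \<subseteq> punctured x"
      proof
        fix z assume "z \<in> (\<Union>i<m. E i)"
        then obtain i where i: "i < m" "z \<in> E i" by blast
        show "z \<in> punctured x"
        proof (cases "z 0 = 0")
          case True
          then have "z N < x N" using i xN by (simp add: E_def)
          with True show ?thesis by (auto simp: punctured_def marked_def)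
        next
          case False
          then have "z 1 = x (z 0)" using i x by (simp add: E_def)
          with False \<open>x 0 = 0\<close> show ?thesis by (auto simp: punctured_def marked_def)
        qed
      qed
    qed
  qed
  then show ?thesis by (intro exI[of _ y'] exI[of _ "Suc N"]) blast
qed

text \<open>
  The condition \<open>x 0 = 0\<close> is a premise rather than a conjunct, in order that the set can be
  comeager in the whole Baire space.
\<close>

definition indistinct :: "baire set set \<Rightarrow> baire set" where
  "indistinct B = {x. x 0 = 0 \<longrightarrow> (punctured x \<in> B \<longleftrightarrow> marked x \<in> B)}"

text \<open>
  If a cylinder contains some \<open>y\<close> with \<open>y 0 = 0\<close> and \<open>marked y\<close> in \<open>U\<close>, then on a smaller cylinder
  both sets are in \<open>U\<close>. Otherwise neither set is in \<open>U\<close> for any \<open>x\<close> in the cylinder with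
  \<open>x 0 = 0\<close>. In both cases upward closure of \<open>U\<close> leads from \<open>punctured x\<close> to \<open>marked x\<close>.
\<close>

lemma comeager_indistinct_openin:
  assumes U: "openin (rep_topology (opens baire_space)) U"
  shows "comeager (indistinct U)"
proof (rule comeager_if_cylinders)
  fix x k
  have up: "punctured y \<in> U \<Longrightarrow> marked y \<in> U" for y
    by (rule openin_opens_upward_closed[OF U _ _ open_marked]) (auto simp: punctured_def)
  show "\<exists>y j. cylinder (init_seg y j) \<subseteq> indistinct U \<inter> cylinder (init_seg x k)"
  proof (cases "\<exists>y \<in> cylinder (init_seg x k). y 0 = 0 \<and> marked y \<in> U")
    case True
    then obtain y where y: "y \<in> cylinder (init_seg x k)" "y 0 = 0" "marked y \<in> U" by blast
    from y(1) have "init_seg y k = init_seg x k"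
      by (simp add: cylinder_def)
    moreover have "{x. punctured x \<in> U} \<subseteq> indistinct U"
      using up by (auto simp: indistinct_def)
    ultimately show ?thesis
      using punctured_mem_generic[OF U y(2,3), of k] by (metis Int_mono order_refl order_trans)
  next
    case False
    then have "cylinder (init_seg x k) \<subseteq> indistinct U"
      using up by (auto simp: indistinct_def)
    then show ?thesis by blast
  qed
qed

text \<open>
  Indistinguishability for a set and for its complement is the same condition, and countable
  unions cost only a countable intersection of comeager sets.
\<close>

lemma comeager_indistinct_borel:
  assumes "borel_subset (rep_topology (opens baire_space)) B"
  shows "comeager (indistinct B)"
  using assms unfolding borel_subset_def
proof (induction rule: sigma_sets.induct)
  case (Basic U)
  then show ?case by (simp add: comeager_indistinct_openin)
next
  case Empty
  show ?case by (simp add: comeager_indistinct_openin)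
next
  case (Compl B)
  have "indistinct (topspace (rep_topology (opens baire_space)) - B) = indistinct B"
    by (auto simp: indistinct_def topspace_rep_topology ran_opens_baire_space open_marked open_punctured)
  with Compl show ?case by simp
next
  case (Union B)
  have "(\<Inter>i. indistinct (B i)) \<subseteq> indistinct (\<Union>i. B i)"
    by (auto simp: indistinct_def)
  then show ?case using comeager_INT comeager_mono Union.IH by metis
qed

text \<open>
  An open set \<open>P\<close> defines a relation between numbers \<open>n > 0\<close> and \<open>m\<close>, namely that \<open>P\<close> meets the
  cylinder \<open>[n, m]\<close>. The second disjunct says that \<open>P\<close> contains a selector of this relation
  with first coordinate zero. For \<open>x 0 = 0\<close> the sets \<open>marked x\<close> and \<open>punctured x\<close> define the
  same relation; its only selector with first coordinate zero is \<open>x\<close>, a point of the former only.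
  The first disjunct admits every \<open>P\<close> whose relation is not total; this is what makes the set
  \<open>\<Sigma>\<^sub>2\<close>: over a total relation, a finite partial selector whose cylinder lies in \<open>P\<close> always
  extends to a selector in \<open>P\<close>, and such a partial selector is found in a finite part of a name.
\<close>

definition selector_sets :: "baire set set" where
  "selector_sets = {P. open P \<and> ((\<exists>n. P \<inter> cylinder [n] = {}) \<or>
     (\<exists>x\<in>P. x 0 = 0 \<and> (\<forall>n>0. P \<inter> cylinder [n, x n] \<noteq> {})))}"

lemma mem_cylinder_1: "z \<in> cylinder [n] \<longleftrightarrow> z 0 = n"
  by (simp add: cylinder_iff)

lemma mem_cylinder_2: "z \<in> cylinder [n, m] \<longleftrightarrow> z 0 = n \<and> z 1 = m"
  by (auto simp: cylinder_iff less_Suc_eq numeral_2_eq_2)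

lemma marked_mem_selector_sets:
  assumes "x 0 = 0"
  shows "marked x \<in> selector_sets"
proof -
  have "(\<lambda>i. if i = 0 then n else x n) \<in> marked x \<inter> cylinder [n, x n]" for n
    by (simp add: marked_def mem_cylinder_2)
  then have "marked x \<inter> cylinder [n, x n] \<noteq> {}" for n by blast
  moreover have "x \<in> marked x" using assms by (simp add: marked_def)
  ultimately show ?thesis using assms open_marked by (auto simp: selector_sets_def)
qed

lemma punctured_notin_selector_sets:
  assumes "x 0 = 0"
  shows "punctured x \<notin> selector_sets"
proof
  assume "punctured x \<in> selector_sets"
  then consider n where "punctured x \<inter> cylinder [n] = {}"
    | y where "y \<in> punctured x" "y 0 = 0" "\<forall>n>0. punctured x \<inter> cylinder [n, y n] \<noteq> {}"
    unfolding selector_sets_def by blast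
  then show False
  proof cases
    case (1 n)
    \<comment> \<open>The successor makes the point differ from \<open>x\<close>, which matters for \<open>n = 0\<close>.\<close>
    have "(\<lambda>i. if i = 0 then n else if i = 1 then x n else Suc (x i)) \<in> punctured x \<inter> cylinder [n]"
      by (auto simp: punctured_def marked_def mem_cylinder_1 dest: fun_cong[of _ _ 2])
    with 1 show False by blast
  next
    case (2 y)
    have "y n = x n" for n
    proof (cases "n = 0")
      case False
      then obtain z where "z \<in> punctured x" "z \<in> cylinder [n, y n]" using 2(3) by blast
      with False show ?thesis by (auto simp: punctured_def marked_def mem_cylinder_2)
    qed (use 2 assms in simp)
    then have "y = x" by blast
    with 2(1) show False by (simp add: punctured_def)
  qed
qed

lemma selector_sets_not_borel:
  "\<not> borel_subset (rep_topology (opens baire_space)) selector_sets"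
proof
  assume "borel_subset (rep_topology (opens baire_space)) selector_sets"
  then have "comeager (indistinct selector_sets)" by (rule comeager_indistinct_borel)
  moreover have "(\<lambda>_. 0) \<in> cylinder [0]" by (simp add: mem_cylinder_1)
  ultimately obtain x where "x \<in> indistinct selector_sets" "x \<in> cylinder [0]"
    using comeager_meets_open[OF _ open_cylinder] by blast
  then show False
    using marked_mem_selector_sets punctured_notin_selector_sets
    by (auto simp: indistinct_def mem_cylinder_1)
qed

section \<open>Effectivity\<close>

text \<open>
  The finite approximations to \<^const>\<open>selector_sets\<close>, in terms of an initial segment \<open>s\<close> of a
  name. The segment hits \<open>w\<close> if it already shows that the open set meets the cylinder \<open>w\<close>. It
  captures a partial selector if the guard of an affirmative entry has, apart from a first
  coordinate zero, only values that are already known to belong to the relation.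
\<close>

definition compatible :: "nat list \<Rightarrow> nat list \<Rightarrow> bool" where
  "compatible u w \<longleftrightarrow> (\<forall>i < length u. i < length w \<longrightarrow> u ! i = w ! i)"

definition hits :: "nat list \<Rightarrow> nat list \<Rightarrow> bool" where
  "hits s w \<longleftrightarrow> (\<exists>e \<in> set s. affirmative e \<and> compatible (guard e) w)"

definition captures :: "nat list \<Rightarrow> bool" where
  "captures s \<longleftrightarrow> (\<exists>e \<in> set s. affirmative e \<and> compatible (guard e) [0] \<and>
     (\<forall>j < length (guard e). 0 < j \<longrightarrow> hits s [j, guard e ! j]))"

lemma compatible_iff: "compatible u w \<longleftrightarrow> cylinder u \<inter> cylinder w \<noteq> {}"
proof
  assume c: "compatible u w"
  have "(\<lambda>i. if i < length u then u ! i else nth_default 0 w i) \<in> cylinder u \<inter> cylinder w"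
    using c by (auto simp: cylinder_iff compatible_def nth_default_nth)
  then show "cylinder u \<inter> cylinder w \<noteq> {}" by blast
next
  assume "cylinder u \<inter> cylinder w \<noteq> {}"
  then obtain x where "x \<in> cylinder u" "x \<in> cylinder w" by blast
  then show "compatible u w" by (auto simp: compatible_def cylinder_iff)
qed

lemma set_init_seg: "set (init_seg p k) = p ` {..<k}"
  by (auto simp: init_seg_def)

lemma hits_mono: "set s \<subseteq> set t \<Longrightarrow> hits s w \<Longrightarrow> hits t w"
  unfolding hits_def by blast

lemma meets_iff_hits:
  assumes "opens baire_space p = Some P"
  shows "P \<inter> cylinder w \<noteq> {} \<longleftrightarrow> (\<exists>k. hits (init_seg p k) w)"
proof -
  have "P \<inter> cylinder w \<noteq> {} \<longleftrightarrow> (\<exists>x k. affirmative (p k) \<and> x \<in> cylinder (guard (p k)) \<inter> cylinder w)"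
    using mem_iff_affirmative_entry[OF assms] by blast
  also have "\<dots> \<longleftrightarrow> (\<exists>k. affirmative (p k) \<and> compatible (guard (p k)) w)"
    unfolding compatible_iff by blast
  also have "\<dots> \<longleftrightarrow> (\<exists>k. hits (init_seg p k) w)"
    unfolding hits_def set_init_seg by (auto intro: exI[of _ "Suc _"])
  finally show ?thesis .
qed

text \<open>
  The right-hand side merges the two disjuncts in the definition of \<^const>\<open>selector_sets\<close>. If \<open>P\<close>
  misses \<open>[n]\<close>, then \<open>n\<close> is a witness, as \<open>[n]\<close> is never hit. If \<open>P\<close> contains a selector, then all
  sufficiently long segments capture a part of it, and their common length bound is a witness.
  Conversely, if \<open>P\<close> meets every \<open>[n]\<close>, a witness forces some segment to capture a partial
  selector, and the values beyond its length are supplied by points of \<open>P\<close> in the sets \<open>[m]\<close>.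
\<close>

lemma selector_sets_iff_names:
  assumes p: "opens baire_space p = Some P"
  shows "P \<in> selector_sets \<longleftrightarrow> (\<exists>n. \<forall>k. k < n \<or> \<not> hits (init_seg p k) [n] \<or> captures (init_seg p k))"
proof -
  note mem = mem_iff_affirmative_entry[OF p] and meets = meets_iff_hits[OF p]
  have "P \<in> ran (opens baire_space)" using p by (auto simp: ran_def)
  then have "open P" by (simp add: ran_opens_baire_space)
  have sub: "set (init_seg p i) \<subseteq> set (init_seg p j)" if "i \<le> j" for i j
    using that by (auto simp: set_init_seg)
  show ?thesis
  proof
    assume "P \<in> selector_sets"
    then consider n where "P \<inter> cylinder [n] = {}"
      | x where "x \<in> P" "x 0 = 0" "\<forall>n>0. P \<inter> cylinder [n, x n] \<noteq> {}"
      unfolding selector_sets_def by blast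
    then show "\<exists>n. \<forall>k. k < n \<or> \<not> hits (init_seg p k) [n] \<or> captures (init_seg p k)"
    proof cases
      case (1 n)
      then show ?thesis using meets by blast
    next
      case (2 x)
      then obtain i where i: "affirmative (p i)" "x \<in> cylinder (guard (p i))" using mem by blast
      have "\<forall>j>0. \<exists>k. hits (init_seg p k) [j, x j]" using 2(3) meets by blast
      then obtain f where f: "\<And>j. 0 < j \<Longrightarrow> hits (init_seg p (f j)) [j, x j]" by metis
      define K where "K = Suc i + (\<Sum>j<length (guard (p i)). f j)"
      have "captures (init_seg p k)" if "K \<le> k" for k
        unfolding captures_def
      proof (intro bexI[of _ "p i"] conjI allI impI)
        show "p i \<in> set (init_seg p k)" using that by (auto simp: set_init_seg K_def)
        show "compatible (guard (p i)) [0]"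
          using i(2) 2(2) unfolding compatible_iff by (auto simp: mem_cylinder_1)
        fix j assume j: "j < length (guard (p i))" "0 < j"
        have "f j \<le> (\<Sum>j<length (guard (p i)). f j)" using j by (intro member_le_sum) auto
        then have "f j \<le> k" using that by (simp add: K_def)
        moreover have "guard (p i) ! j = x j" using i(2) j(1) by (simp add: cylinder_iff)
        ultimately show "hits (init_seg p k) [j, guard (p i) ! j]"
          using f[OF j(2)] hits_mono[OF sub] by simp
      qed (rule i(1))
      then show ?thesis by (meson not_le)
    qed
  next
    assume "\<exists>n. \<forall>k. k < n \<or> \<not> hits (init_seg p k) [n] \<or> captures (init_seg p k)"
    then obtain n where n: "\<And>k. k < n \<or> \<not> hits (init_seg p k) [n] \<or> captures (init_seg p k)"
      by blast
    show "P \<in> selector_sets"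
    proof (cases "\<exists>n. P \<inter> cylinder [n] = {}")
      case True
      then show ?thesis using \<open>open P\<close> by (simp add: selector_sets_def)
    next
      case False
      then have "\<exists>z. z \<in> P \<and> z 0 = m" for m by (metis disjoint_iff mem_cylinder_1)
      then obtain z where z: "\<And>m. z m \<in> P" "\<And>m. z m 0 = m" by metis
      obtain k where "hits (init_seg p k) [n]" using False meets by blast
      then have "hits (init_seg p (max k n)) [n]" by (rule hits_mono[OF sub, rotated]) simp
      then have "captures (init_seg p (max k n))" using n[of "max k n"] by simp
      then obtain i where i: "affirmative (p i)" "compatible (guard (p i)) [0]"
        "\<And>j. j < length (guard (p i)) \<Longrightarrow> 0 < j \<Longrightarrow> hits (init_seg p (max k n)) [j, guard (p i) ! j]"
        unfolding captures_def set_init_seg by blast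
      define u where "u = guard (p i)"
      define x where "x j = (if j = 0 then 0 else if j < length u then u ! j else z j 1)" for j
      have "x \<in> cylinder u"
        using i(2) by (auto simp: cylinder_iff x_def compatible_def u_def)
      then have "x \<in> P" using mem i(1) u_def by blast
      moreover have "P \<inter> cylinder [m, x m] \<noteq> {}" if "0 < m" for m
      proof (cases "m < length u")
        case True
        then show ?thesis using i(3) that unfolding meets by (auto simp: x_def u_def)
      next
        case False
        then have "z m \<in> cylinder [m, x m]" using that z by (simp add: mem_cylinder_2 x_def)
        then show ?thesis using z(1) by blast
      qed
      moreover have "x 0 = 0" by (simp add: x_def)
      ultimately show ?thesis unfolding selector_sets_def using \<open>open P\<close> by blast
    qed
  qed
qed

text \<open>
  For fixed \<open>n\<close>, the points all of whose initial segments satisfy \<open>Q n\<close> form the complement of the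
  union of the cylinders \<open>u\<close> that violate \<open>Q n\<close>, and those cylinders are decidable uniformly in \<open>n\<close>.
\<close>

lemma lightface_Sigma02_if_decidable:
  assumes "decidable 2 (\<lambda>xs. Q (xs ! 0) (list_decode (xs ! 1)))"
  shows "lightface_Sigma02 {p. \<exists>n. \<forall>k. Q n (init_seg p k)}"
proof -
  have c: "computable 2 (\<lambda>xs. fst (prod_decode (xs ! 0)))"
    "computable 2 (\<lambda>xs. snd (prod_decode (xs ! 0)))"
    by (intro computable_fst_prod_decode computable_snd_prod_decode computable_proj; simp)+
  have "computable 2 (\<lambda>xs. of_bool (Q (fst (prod_decode (xs ! 0))) (list_decode (snd (prod_decode (xs ! 0))))))"
    using computable_comp[of "[\<lambda>xs. fst (prod_decode (xs ! 0)), \<lambda>xs. snd (prod_decode (xs ! 0))]"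
        "\<lambda>xs. of_bool (Q (xs ! 0) (list_decode (xs ! 1)))" 2] assms c
    by (auto simp: decidable_def numeral_2_eq_2)
  then obtain f where f: "recursive_fun 2 f" "\<And>xs. length xs = 2 \<Longrightarrow>
      of_bool (Q (fst (prod_decode (xs ! 0))) (list_decode (snd (prod_decode (xs ! 0))))) = f xs"
    unfolding computable_def by blast
  define W where "W = {x. \<exists>y. f [x, y] = 0}"
  have "comp_enum W" unfolding comp_enum_def W_def using f(1) by blast
  moreover have W: "prod_encode (n, list_encode u) \<in> W \<longleftrightarrow> \<not> Q n u" for n u
    by (simp add: W_def flip: f(2))
  have cyl: "p \<in> cylinder u \<longleftrightarrow> (\<exists>k. u = init_seg p k)" for p u
  proof
    assume "p \<in> cylinder u"
    then have "u = init_seg p (length u)" by (simp add: cylinder_def)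
    then show "\<exists>k. u = init_seg p k" by (rule exI)
  qed (auto simp: cylinder_def)
  have "{p. \<exists>n. \<forall>k. Q n (init_seg p k)} =
      (\<Union>n. - (\<Union>u \<in> {u. prod_encode (n, list_encode u) \<in> W}. cylinder u))"
    by (rule set_eqI) (auto simp: W cyl)
  ultimately show ?thesis unfolding lightface_Sigma02_def by blast
qed

lemma decidable_affirmative:
  "computable n f \<Longrightarrow> decidable n (\<lambda>xs. affirmative (f xs))"
  unfolding affirmative_def
  by (intro decidable_bex_set decidable_not decidable_eq computable_snd_prod_decode computable_proj
      computable_const) auto

lemma decidable_compatible:
  assumes "computable n f" "computable n g"
  shows "decidable n (\<lambda>xs. compatible (list_decode (f xs)) (list_decode (g xs)))"
proof -
  have eq: "compatible u w \<longleftrightarrow>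
      (\<forall>i < length u. i < length w \<longrightarrow> nth_default 0 u i = nth_default 0 w i)" for u w
    by (auto simp: compatible_def nth_default_nth)
  show ?thesis unfolding eq
    by (intro decidable_ball_less decidable_imp decidable_less decidable_eq computable_nth
        computable_length computable_weaken[OF assms(1)] computable_weaken[OF assms(2)]
        computable_proj assms) auto
qed

lemma decidable_hits:
  assumes "computable n f" "computable n g"
  shows "decidable n (\<lambda>xs. hits (list_decode (f xs)) (list_decode (g xs)))"
  unfolding hits_def guard_def
  by (intro decidable_bex_set decidable_and decidable_affirmative decidable_compatible
      computable_fst_prod_decode computable_weaken[OF assms(2)] computable_proj assms) auto

lemma list_decode_singleton: "list_decode (Suc (prod_encode (a, 0))) = [a]"
  and list_decode_pair: "list_decode (Suc (prod_encode (a, Suc (prod_encode (b, 0))))) = [a, b]"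
  by simp_all

text \<open>
  Under the two quantifiers of \<^const>\<open>captures\<close> the entry is the second argument and the parameters
  of \<open>f\<close> start at the third, whence the two auxiliary facts about iterated tails.
\<close>

lemma decidable_captures:
  assumes f: "computable n f"
  shows "decidable n (\<lambda>xs. captures (list_decode (f xs)))"
proof -
  have eq: "captures s \<longleftrightarrow> (\<exists>e \<in> set s. affirmative e \<and>
      compatible (list_decode (fst (prod_decode e))) (list_decode (Suc (prod_encode (0, 0)))) \<and>
      (\<forall>j < length (list_decode (fst (prod_decode e))). 0 < j \<longrightarrow>
        hits s (list_decode (Suc (prod_encode (j, Suc (prod_encode
          (nth_default 0 (list_decode (fst (prod_decode e))) j, 0))))))))" for s
    unfolding captures_def guard_def list_decode_singleton list_decode_pair
    by (auto simp: nth_default_nth)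
  have f2: "computable (Suc (Suc n)) (\<lambda>zs. f (tl (tl zs)))"
    using computable_weaken[OF computable_weaken[OF f]] .
  have e: "computable (Suc (Suc n)) (\<lambda>zs. tl zs ! 0)"
    by (rule computable_weaken[OF computable_proj]) simp
  show ?thesis unfolding eq
    by (intro decidable_bex_set decidable_and decidable_affirmative decidable_compatible
      decidable_ball_less decidable_imp decidable_less decidable_hits computable_Suc
      computable_prod_encode computable_nth computable_length computable_fst_prod_decode
      computable_const f2 e computable_proj f zero_less_Suc)
qed

theorem theorem3p1:
  shows "\<exists>A. Sigma02_subset (opens baire_space) A \<and>
             \<not> borel_subset (rep_topology (opens baire_space)) A"
proof (intro exI conjI)
  show "\<not> borel_subset (rep_topology (opens baire_space)) selector_sets"
    by (rule selector_sets_not_borel)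
  define B where "B = {p. \<exists>n. \<forall>k. length (init_seg p k) < n \<or> \<not> hits (init_seg p k) [n] \<or>
    captures (init_seg p k)}"
  have "decidable 2 (\<lambda>xs. length (list_decode (xs ! 1)) < xs ! 0 \<or>
      \<not> hits (list_decode (xs ! 1)) (list_decode (Suc (prod_encode (xs ! 0, 0)))) \<or>
      captures (list_decode (xs ! 1)))"
    by (intro decidable_or decidable_not decidable_less decidable_hits decidable_captures
      computable_length computable_Suc computable_prod_encode computable_const computable_proj) auto
  then have "lightface_Sigma02 B"
    unfolding B_def list_decode_singleton
    by (rule lightface_Sigma02_if_decidable[where Q = "\<lambda>n s. length s < n \<or> \<not> hits s [n] \<or> captures s"])
  moreover have "{p \<in> dom (opens baire_space). the (opens baire_space p) \<in> selector_sets} =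
      B \<inter> dom (opens baire_space)"
  proof -
    have "P \<in> selector_sets \<longleftrightarrow> p \<in> B" if "opens baire_space p = Some P" for p P
      unfolding B_def by (simp add: selector_sets_iff_names[OF that])
    then show ?thesis by auto
  qed
  moreover have "selector_sets \<subseteq> ran (opens baire_space)"
    by (auto simp: ran_opens_baire_space selector_sets_def)
  ultimately show "Sigma02_subset (opens baire_space) selector_sets"
    unfolding Sigma02_subset_def by blast
qed

end
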